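(* Let $G$ be a finitely generated LPF group with $\nabla G>0$, and let $A,B$ be finitely generated subgroups of infinite index in $G$. Then there is a finite index subgroup $B_0\le B$ such that $[G:\langle A\cup B_0\rangle]=\infty$.
   Context: For a group $U$, $d(U)$ denotes the minimal cardinality of a generating set of $U$. The rank gradient of a finitely generated group $G$ is $\nabla G=\inf_U \frac{d(U)-1}{[G:U]}$, where $U$ ranges over all finite index subgroups of $G$. The proindex of a subgroup $H$ in $G$ is the supremum of the indices $[G:U]$ over finite index subgroups $U$ of $G$ containing $H$. A group $G$ is LPF if for every finitely generated subgroup of $G$ its index and proindex in $G$ coincide. *)

theory Defs
  imports Complex_Main "HOL-Algebra.Algebra" "HOL-Library.Extended_Nat"
begin

definition fg_subgroup :: "('a, 'b) monoid_scheme \<Rightarrow> 'a set \<Rightarrow> bool" where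
  "fg_subgroup G H \<longleftrightarrow> subgroup H G \<and> (\<exists>S. finite S \<and> S \<subseteq> carrier G \<and> generate G S = H)"

definition fg_group :: "('a, 'b) monoid_scheme \<Rightarrow> bool" where
  "fg_group G \<longleftrightarrow> group G \<and> fg_subgroup G (carrier G)"

definition min_gens :: "('a, 'b) monoid_scheme \<Rightarrow> 'a set \<Rightarrow> nat" where
  "min_gens G U = (LEAST n. \<exists>S. finite S \<and> S \<subseteq> carrier G \<and> card S = n \<and> generate G S = U)"

definition gindex :: "('a, 'b) monoid_scheme \<Rightarrow> 'a set \<Rightarrow> enat" where
  "gindex G H = (if finite (rcosets\<^bsub>G\<^esub> H) then enat (card (rcosets\<^bsub>G\<^esub> H)) else \<infinity>)"

definition finite_index :: "('a, 'b) monoid_scheme \<Rightarrow> 'a set \<Rightarrow> bool" where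
  "finite_index G U \<longleftrightarrow> subgroup U G \<and> finite (rcosets\<^bsub>G\<^esub> U)"

definition rank_gradient :: "('a, 'b) monoid_scheme \<Rightarrow> real" where
  "rank_gradient G = Inf {(real (min_gens G U) - 1) / real (card (rcosets\<^bsub>G\<^esub> U)) | U. finite_index G U}"

definition proindex :: "('a, 'b) monoid_scheme \<Rightarrow> 'a set \<Rightarrow> enat" where
  "proindex G H = Sup {enat (card (rcosets\<^bsub>G\<^esub> U)) | U. finite_index G U \<and> H \<subseteq> U}"

definition LPF :: "('a, 'b) monoid_scheme \<Rightarrow> bool" where
  "LPF G \<longleftrightarrow> (\<forall>H. fg_subgroup G H \<longrightarrow> gindex G H = proindex G H)"

end

theory Submission
  imports Defs
begin

text \<open>
  If \<open>U \<supseteq> A\<close> and \<open>V \<supseteq> B\<close> have finite index, then \<open>A \<inter> V\<close> and \<open>B \<inter> U\<close> lie in \<open>U \<inter> V\<close>, whose index is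
  at least \<open>[G:U] [A : A \<inter> V]\<close> and at least \<open>[G:V] [B : B \<inter> U]\<close>. Since the rank of a finite index
  subgroup grows at most linearly with the index, for \<open>[G:U]\<close> and \<open>[G:V]\<close> large the subgroup
  \<open>H = \<langle>(A \<inter> V) \<union> (B \<inter> U)\<rangle>\<close> has too few generators to be of finite index in a group of positive
  rank gradient. Hence, by LPF, \<open>H\<close> lies in finite index subgroups \<open>P\<close> of arbitrarily large index, and
  the intersection \<open>D\<close> of the \<open>A\<close>-conjugates of \<open>P\<close> is normalised by \<open>A\<close>, while \<open>[A : A \<inter> D]\<close> is
  bounded independently of \<open>P\<close>. Thus \<open>\<langle>A \<union> (B \<inter> U \<inter> D)\<rangle> \<subseteq> DA\<close> again has an index that is too large
  for its number of generators once \<open>[G:P]\<close> is large enough.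

  The relative index \<open>[A : A \<inter> V]\<close> is expressed throughout as the number \<open>card ((#>) V ` A)\<close> of right
  cosets of \<open>V\<close> that meet \<open>A\<close>.
\<close>

section \<open>Right cosets and index inequalities\<close>

text \<open>On \<open>S\<close> the map \<open>f\<close> factors through \<open>h\<close>: choose a
  preimage under \<open>h\<close> and apply \<open>f\<close>. With coset maps for \<open>h\<close>
  and \<open>f\<close>, this compares how many cosets of two subgroups meet a given set.\<close>

lemma image_factor:
  assumes "finite (h ` S)" and "\<And>x y. x \<in> S \<Longrightarrow> y \<in> S \<Longrightarrow> h x = h y \<Longrightarrow> f x = f y"
  shows finite_image_factor: "finite (f ` S)" and card_image_factor: "card (f ` S) \<le> card (h ` S)"
proof -
  have "f ` S \<subseteq> (\<lambda>z. f (inv_into S h z)) ` (h ` S)"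
  proof
    fix w assume "w \<in> f ` S"
    then obtain x where x: "x \<in> S" "w = f x" by blast
    have "f (inv_into S h (h x)) = f x"
      by (rule assms(2)) (use x in \<open>auto intro: inv_into_into f_inv_into_f\<close>)
    then show "w \<in> (\<lambda>z. f (inv_into S h z)) ` (h ` S)" using x by force
  qed
  then show "finite (f ` S)" "card (f ` S) \<le> card (h ` S)"
    using assms(1) finite_surj surj_card_le by blast+
qed

context group
begin

lemma inv_mult_cancel_left:
  assumes "x \<in> carrier G" "y \<in> carrier G"
  shows "inv x \<otimes> (x \<otimes> y) = y" "x \<otimes> (inv x \<otimes> y) = y"
  using assms by (simp_all flip: m_assoc)

lemma rcosets_eq_image: "rcosets H = (#>) H ` carrier G"
  by (auto simp: RCOSETS_def)

lemma rcoset_eq_iff: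
  assumes "subgroup H G" "x \<in> carrier G" "y \<in> carrier G"
  shows "H #> x = H #> y \<longleftrightarrow> x \<otimes> inv y \<in> H"
proof
  assume "H #> x = H #> y"
  then have "x \<in> H #> y" using assms rcos_self by blast
  then show "x \<otimes> inv y \<in> H" using assms
    by (metis subgroup.rcos_module_imp is_group)
next
  assume "x \<otimes> inv y \<in> H"
  then have "x \<in> H #> y" using assms
    by (metis subgroup.rcos_module_rev is_group)
  then show "H #> x = H #> y" using assms repr_independence by metis
qed

lemma finite_index_Int:
  assumes "finite_index G U" "finite_index G V"
  shows "finite_index G (U \<inter> V)"
proof -
  have sub: "subgroup U G" "subgroup V G" "subgroup (U \<inter> V) G"
    using assms by (auto simp: finite_index_def intro: subgroups_Inter_pair)
  have "finite ((#>) (U \<inter> V) ` carrier G)"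
  proof (rule finite_image_factor)
    show "finite ((\<lambda>x. (U #> x, V #> x)) ` carrier G)"
      by (rule finite_subset[of _ "(rcosets U) \<times> (rcosets V)"])
        (use assms in \<open>auto simp: finite_index_def rcosets_eq_image\<close>)
  qed (use sub in \<open>auto simp: rcoset_eq_iff\<close>)
  then show ?thesis using sub by (simp add: finite_index_def rcosets_eq_image)
qed

text \<open>Two elements of \<open>B\<close> in the same coset of \<open>U\<close> are already in
  the same coset of \<open>B \<inter> U\<close>.\<close>

lemma finite_index_restrict:
  assumes "finite_index G U" "subgroup B G"
  shows "finite_index (G\<lparr>carrier := B\<rparr>) (B \<inter> U)"
proof -
  have sub: "subgroup U G" "subgroup (B \<inter> U) G"
    using assms by (auto simp: finite_index_def intro: subgroups_Inter_pair)
  have BG: "B \<subseteq> carrier G" using assms subgroup.subset by blast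
  have "finite ((#>) U ` B)"
    using assms BG unfolding finite_index_def rcosets_eq_image
    by (meson finite_subset image_mono)
  then have "finite ((#>) (B \<inter> U) ` B)"
    by (rule finite_image_factor)
      (use sub BG assms(2) in \<open>auto simp: rcoset_eq_iff subset_iff subgroup.m_closed subgroup.m_inv_closed\<close>)
  moreover have "rcosets\<^bsub>G\<lparr>carrier := B\<rparr>\<^esub> (B \<inter> U) = (#>) (B \<inter> U) ` B"
    by (auto simp: RCOSETS_def r_coset_def)
  moreover have "subgroup (B \<inter> U) (G\<lparr>carrier := B\<rparr>)"
    using assms(2) sub by (simp add: subgroup_incl)
  ultimately show ?thesis by (simp add: finite_index_def)
qed

text \<open>Translate the cosets of \<open>E\<close> that meet \<open>A\<close> by representatives
  of the cosets of \<open>U\<close>. All of these translates are distinct: as \<open>A\<close> and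
  \<open>E\<close> lie in \<open>U\<close>, a translate determines its coset of \<open>U\<close>,
  and the representative then cancels.\<close>

lemma card_rcosets_ge_mult:
  assumes E: "finite_index G E" and U: "subgroup U G" and "E \<subseteq> U" "A \<subseteq> U"
  shows "card (rcosets U) * card ((#>) E ` A) \<le> card (rcosets E)"
proof -
  have Es: "subgroup E G" and fin: "finite (rcosets E)" using E by (auto simp: finite_index_def)
  have UG: "U \<subseteq> carrier G" using U subgroup.subset by blast
  define t where "t Y = inv_into (carrier G) ((#>) U) Y" for Y
  have t: "t Y \<in> carrier G" "U #> t Y = Y" if "Y \<in> rcosets U" for Y
    using that unfolding rcosets_eq_image t_def by (rule inv_into_into, rule f_inv_into_f)
  let ?f = "\<lambda>(Y, Q). Q #> t Y"
  have "inj_on ?f ((rcosets U) \<times> (#>) E ` A)"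
  proof (rule inj_onI, clarify)
    fix Y Y' a a'
    assume Y: "Y \<in> rcosets U" "Y' \<in> rcosets U" and a: "a \<in> A" "a' \<in> A"
      and eq: "E #> a #> t Y = E #> a' #> t Y'"
    have aU: "a \<in> U" "a' \<in> U" and aG: "a \<in> carrier G" "a' \<in> carrier G"
      using a assms UG by auto
    have EG: "E \<subseteq> carrier G" using Es subgroup.subset by blast
    have eq2: "E #> (a \<otimes> t Y) = E #> (a' \<otimes> t Y')"
      using eq aG t Y EG by (simp add: coset_mult_assoc)
    then have "a \<otimes> t Y \<otimes> inv (a' \<otimes> t Y') \<in> U"
      using aG t Y Es assms(3) by (auto simp: rcoset_eq_iff)
    then have "U #> (a \<otimes> t Y) = U #> (a' \<otimes> t Y')"
      using aG t Y U by (simp add: rcoset_eq_iff)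
    then have "U #> a #> t Y = U #> a' #> t Y'"
      using aG t Y UG by (simp add: coset_mult_assoc)
    then have YY: "Y = Y'"
      using t Y aU U by (simp add: coset_join2 subgroup.mem_carrier)
    then have "E #> a = E #> a'"
      using eq2 aG t Y Es by (simp add: rcoset_eq_iff inv_mult_group m_assoc inv_mult_cancel_left)
    then show "Y = Y' \<and> E #> a = E #> a'" using YY by simp
  qed
  moreover have "?f ` ((rcosets U) \<times> (#>) E ` A) \<subseteq> rcosets E"
  proof clarify
    fix Y a assume Y: "Y \<in> rcosets U" and a: "a \<in> A"
    have aG: "a \<in> carrier G" using a assms UG by auto
    have EG: "E \<subseteq> carrier G" using Es subgroup.subset by blast
    show "E #> a #> t Y \<in> rcosets E"
      using aG t[OF Y] EG by (auto simp: coset_mult_assoc rcosets_eq_image)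
  qed
  ultimately have "card ((rcosets U) \<times> (#>) E ` A) \<le> card (rcosets E)"
    using fin card_inj_on_le by blast
  then show ?thesis by (simp add: card_cartesian_product)
qed

text \<open>Any \<open>g\<close> is some \<open>w\<close> in \<open>W\<close> times the
  representative of \<open>W #> g\<close>, so its \<open>D\<close>-coset is a translate of one that
  meets \<open>W\<close>. \<open>D\<close> may fail to lie in \<open>W\<close>, which is how the
  bound is used for \<open>W \<subseteq> D <#> A\<close>.\<close>

lemma card_rcosets_le_mult:
  assumes W: "finite_index G W" and D: "subgroup D G" and fin: "finite ((#>) D ` W)"
  shows "card (rcosets D) \<le> card ((#>) D ` W) * card (rcosets W)"
proof -
  have Ws: "subgroup W G" and finW: "finite (rcosets W)" using W by (auto simp: finite_index_def)
  have DG: "D \<subseteq> carrier G" using D subgroup.subset by blast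
  define t where "t Y = inv_into (carrier G) ((#>) W) Y" for Y
  have t: "t Y \<in> carrier G" "W #> t Y = Y" if "Y \<in> rcosets W" for Y
    using that unfolding rcosets_eq_image t_def by (rule inv_into_into, rule f_inv_into_f)
  have "rcosets D \<subseteq> (\<lambda>(Q, Y). Q #> t Y) ` ((#>) D ` W \<times> (rcosets W))"
  proof
    fix Z assume "Z \<in> rcosets D"
    then obtain g where g: "g \<in> carrier G" "Z = D #> g" by (auto simp: rcosets_eq_image)
    let ?Y = "W #> g"
    have Y: "?Y \<in> rcosets W" using g by (auto simp: rcosets_eq_image)
    then have w: "g \<otimes> inv (t ?Y) \<in> W" using t[OF Y] g Ws rcoset_eq_iff by metis
    have "D #> (g \<otimes> inv (t ?Y)) #> t ?Y = Z"
      using DG g t[OF Y] by (simp add: coset_mult_assoc m_assoc)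
    then show "Z \<in> (\<lambda>(Q, Y). Q #> t Y) ` ((#>) D ` W \<times> (rcosets W))" using w Y by force
  qed
  then have "card (rcosets D) \<le> card ((#>) D ` W \<times> (rcosets W))"
    using fin finW by (intro surj_card_le finite_cartesian_product)
  then show ?thesis by (simp add: card_cartesian_product)
qed

lemma card_rcosets_antimono:
  assumes "finite_index G H" "subgroup E G" "H \<subseteq> E"
  shows "card (rcosets E) \<le> card (rcosets H)"
proof -
  have "(#>) E ` H \<subseteq> {E}"
    using assms(3) coset_join2[OF _ assms(2)] subgroup.mem_carrier[OF assms(2)] by auto
  then have "finite ((#>) E ` H)" "card ((#>) E ` H) \<le> 1"
    by (auto intro: finite_subset dest: card_mono[rotated])
  then show ?thesis
    using card_rcosets_le_mult[OF assms(1,2)] by (metis mult_le_mono1 le_trans mult_1)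
qed

section \<open>Generators of subgroups of finite relative index\<close>

text \<open>Schreier's lemma for the right action of \<open>A\<close> on the cosets of
  \<open>V\<close> that meet \<open>A\<close>, in which the stabiliser of \<open>V\<close> is
  \<open>A \<inter> V\<close>. The crude bound, one generator for each pair of a coset and an
  element of \<open>S\<close>, suffices for linear growth.\<close>

lemma schreier_generators:
  assumes S: "finite S" "S \<subseteq> carrier G" "generate G S = A" and V: "subgroup V G"
    and fin: "finite ((#>) V ` A)"
  obtains T where "finite T" "T \<subseteq> carrier G" "generate G T = A \<inter> V"
    "card T \<le> card S * card ((#>) V ` A)"
proof -
  have A: "subgroup A G" using S generate_is_subgroup by blast
  have AG: "A \<subseteq> carrier G" and VG: "V \<subseteq> carrier G" using A V subgroup.subset by blast+
  have SA: "S \<subseteq> A" using generate.incl[of _ S G] unfolding S(3) by (rule subsetI)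
  have AV: "subgroup (A \<inter> V) G" using A V subgroups_Inter_pair by blast
  define t where "t Q = inv_into A ((#>) V) Q" for Q
  let ?C = "(#>) V ` A"
  have t: "t Q \<in> A" "V #> t Q = Q" if "Q \<in> ?C" for Q
    using that unfolding t_def by (rule inv_into_into, rule f_inv_into_f)
  have tG: "t Q \<in> carrier G" if "Q \<in> ?C" for Q using t[OF that] AG by blast
  have QG: "Q \<subseteq> carrier G" if "Q \<in> ?C" for Q
    using that r_coset_subset_G[OF VG] AG by blast
  have act: "Q #> x \<in> ?C" if "Q \<in> ?C" "x \<in> A" for Q x
    using that AG VG A by (auto simp: coset_mult_assoc subset_iff intro!: imageI subgroup.m_closed)
  \<comment> \<open>Schreier's elements, defined for every \<open>x\<close> and not only for
    generators, so that they can be followed along a whole word.\<close>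
  define q where "q Q x = t Q \<otimes> x \<otimes> inv (t (Q #> x))" for Q x
  define T where "T = (\<lambda>(s, Q). q Q s) ` (S \<times> ?C)"
  have qAV: "q Q x \<in> A \<inter> V" if Q: "Q \<in> ?C" and x: "x \<in> A" for Q x
  proof -
    have xG: "x \<in> carrier G" using x AG by blast
    have "V #> (t Q \<otimes> x) = V #> t (Q #> x)"
      using t[OF Q] t[OF act[OF Q x]] tG[OF Q] xG VG by (simp flip: coset_mult_assoc)
    then have "q Q x \<in> V"
      unfolding q_def using rcoset_eq_iff[OF V] tG[OF Q] tG[OF act[OF Q x]] xG by simp
    moreover have "q Q x \<in> A"
      unfolding q_def using t[OF Q] t[OF act[OF Q x]] x A
      by (simp add: subgroup.m_closed subgroup.m_inv_closed)
    ultimately show ?thesis by simp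
  qed
  have TAV: "T \<subseteq> A \<inter> V" unfolding T_def using qAV SA by auto
  then have TG: "T \<subseteq> carrier G" using AG by blast
  have sub1: "generate G T \<subseteq> A \<inter> V" using AV TAV generate_subgroup_incl by blast
  have Tsub: "subgroup (generate G T) G" using TG generate_is_subgroup by blast
  \<comment> \<open>The coset \<open>Q\<close> must stay arbitrary: the second factor of a product
    starts from the coset to which the first one leads.\<close>
  have q_gen: "q Q x \<in> generate G T" if "x \<in> generate G S" "Q \<in> ?C" for Q x
    using that
  proof (induction arbitrary: Q rule: generate.induct)
    case one
    have "Q #> \<one> = Q" using QG[OF one] by (rule coset_mult_one)
    then show ?case unfolding q_def using tG[OF one] by (simp add: generate.one)
  next
    case (incl s)
    then show ?case unfolding T_def by (auto intro!: generate.incl)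
  next
    case (inv s)
    have s: "s \<in> A" "s \<in> carrier G" using inv SA AG by auto
    let ?Y = "Q #> inv s"
    have Y: "?Y \<in> ?C" using act inv s A subgroup.m_inv_closed by metis
    have Ys: "?Y #> s = Q" using s QG[OF inv(2)] by (simp add: coset_mult_assoc)
    \<comment> \<open>Multiplying \<open>Q\<close> by \<open>inv s\<close> traverses backwards the
      edge that \<open>s\<close> gives from \<open>?Y\<close> to \<open>Q\<close>.\<close>
    have "q Q (inv s) = inv (q ?Y s)"
      unfolding q_def Ys using tG[OF Y] tG[OF inv(2)] s by (simp add: inv_mult_group m_assoc)
    moreover have "q ?Y s \<in> generate G T" using inv(1) Y unfolding T_def by (auto intro!: generate.incl)
    ultimately show ?case using Tsub subgroup.m_inv_closed by metis
  next
    case (eng x y)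
    have xy: "x \<in> A" "y \<in> A" "x \<in> carrier G" "y \<in> carrier G" using eng S AG by auto
    have Q1: "Q #> x \<in> ?C" using act eng xy by blast
    have Q2: "Q #> x #> y \<in> ?C" using act Q1 xy by blast
    have "q Q (x \<otimes> y) = q Q x \<otimes> q (Q #> x) y"
      unfolding q_def using tG[OF eng(5)] tG[OF Q1] tG[OF Q2] xy QG[OF eng(5)]
      by (simp add: coset_mult_assoc m_assoc inv_mult_cancel_left)
    then show ?case using eng Q1 Tsub subgroup.m_closed by metis
  qed
  have sub2: "A \<inter> V \<subseteq> generate G T"
  proof
    fix x assume x: "x \<in> A \<inter> V"
    have "\<one> \<in> A" using A subgroup.one_closed by blast
    then have "V #> \<one> \<in> ?C" by blast
    then have C: "V \<in> ?C" using VG by (simp add: coset_mult_one)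
    let ?r = "t V"
    have rV: "?r \<in> A \<inter> V" using t[OF C] tG[OF C] V coset_join1 VG by blast
    \<comment> \<open>The representative of \<open>V\<close> itself need not be \<open>\<one>\<close>, so conjugate by it.\<close>
    define y where "y = inv ?r \<otimes> x \<otimes> ?r"
    have y: "y \<in> A \<inter> V" unfolding y_def using rV x AV
      by (meson subgroup.m_closed subgroup.m_inv_closed)
    have G: "x \<in> carrier G" "?r \<in> carrier G" "y \<in> carrier G" using x rV y AG by auto
    have Vy: "V #> y = V" using y V G coset_join2 by blast
    have "q V y = x" unfolding q_def Vy unfolding y_def using G by (simp add: m_assoc inv_mult_cancel_left)
    then show "x \<in> generate G T" using q_gen[of y V] y C S by auto
  qed
  have "finite T" unfolding T_def using S(1) fin by simp
  moreover have "card T \<le> card S * card ?C"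
    unfolding T_def card_cartesian_product[symmetric] using S(1) fin by (intro card_image_le) simp
  ultimately show ?thesis using that TG sub1 sub2 by blast
qed

section \<open>Subgroups normalised by \<open>A\<close>\<close>

text \<open>For a subgroup \<open>P\<close>, this is the intersection of the conjugates of
  \<open>P\<close> by the elements of \<open>A\<close>, written as a membership condition so that no
  family of subgroups has to be handled.\<close>

definition conj_core :: "'a set \<Rightarrow> 'a set \<Rightarrow> 'a set" where
  "conj_core A P = {x \<in> carrier G. \<forall>a\<in>A. a \<otimes> x \<otimes> inv a \<in> P}"

lemma subgroup_conj_core:
  assumes A: "A \<subseteq> carrier G" and P: "subgroup P G"
  shows "subgroup (conj_core A P) G"
proof (rule subgroupI)
  show "conj_core A P \<subseteq> carrier G" by (auto simp: conj_core_def)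
  have "\<one> \<in> conj_core A P"
    using A subgroup.one_closed[OF P] by (auto simp: conj_core_def subset_iff)
  then show "conj_core A P \<noteq> {}" by blast
next
  fix x assume x: "x \<in> conj_core A P"
  have "a \<otimes> inv x \<otimes> inv a \<in> P" if a: "a \<in> A" for a
  proof -
    have G: "a \<in> carrier G" "x \<in> carrier G" using a A x by (auto simp: conj_core_def)
    have "a \<otimes> inv x \<otimes> inv a = inv (a \<otimes> x \<otimes> inv a)"
      using G by (simp add: inv_mult_group m_assoc)
    then show ?thesis using x a subgroup.m_inv_closed[OF P] by (auto simp: conj_core_def)
  qed
  then show "inv x \<in> conj_core A P" using x by (auto simp: conj_core_def)
next
  fix x y assume x: "x \<in> conj_core A P" and y: "y \<in> conj_core A P"
  have "a \<otimes> (x \<otimes> y) \<otimes> inv a \<in> P" if a: "a \<in> A" for a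
  proof -
    have G: "a \<in> carrier G" "x \<in> carrier G" "y \<in> carrier G" using a A x y by (auto simp: conj_core_def)
    have "a \<otimes> (x \<otimes> y) \<otimes> inv a = (a \<otimes> x \<otimes> inv a) \<otimes> (a \<otimes> y \<otimes> inv a)"
      using G by (simp add: m_assoc inv_mult_cancel_left)
    then show ?thesis using x y a subgroup.m_closed[OF P] by (auto simp: conj_core_def)
  qed
  then show "x \<otimes> y \<in> conj_core A P" using x y by (auto simp: conj_core_def)
qed

text \<open>Right multiplication lets the group act on the finitely many cosets of \<open>P\<close>.
  Elements that act in the same way share a coset of the core, and only finitely many actions
  exist.\<close>

lemma finite_index_conj_core:
  assumes A: "A \<subseteq> carrier G" and P: "finite_index G P"
  shows "finite_index G (conj_core A P)"
proof -
  have Ps: "subgroup P G" and fin: "finite (rcosets P)" using P by (auto simp: finite_index_def)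
  have PG: "P \<subseteq> carrier G" using Ps subgroup.subset by blast
  have D: "subgroup (conj_core A P) G" using subgroup_conj_core A Ps by blast
  \<comment> \<open>Restricting to \<open>rcosets P\<close> places these maps in a finite space of
    extensional functions.\<close>
  let ?h = "\<lambda>x. \<lambda>Y\<in>rcosets P. Y #> x"
  have "?h x \<in> rcosets P \<rightarrow>\<^sub>E rcosets P" if "x \<in> carrier G" for x
    using that PG by (auto simp: rcosets_eq_image coset_mult_assoc)
  then have "finite (?h ` carrier G)"
    using fin by (meson finite_PiE finite_subset image_subsetI)
  then have "finite ((#>) (conj_core A P) ` carrier G)"
  proof (rule finite_image_factor)
    fix x y assume x: "x \<in> carrier G" and y: "y \<in> carrier G" and eq: "?h x = ?h y"
    have "a \<otimes> (x \<otimes> inv y) \<otimes> inv a \<in> P" if a: "a \<in> A" for a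
    proof -
      have aG: "a \<in> carrier G" using a A by blast
      have "P #> a \<in> rcosets P" using aG by (auto simp: rcosets_eq_image)
      then have "P #> a #> x = P #> a #> y" using fun_cong[OF eq, of "P #> a"] by simp
      then have "P #> (a \<otimes> x) = P #> (a \<otimes> y)" using PG aG x y by (simp add: coset_mult_assoc)
      then show ?thesis
        using rcoset_eq_iff[OF Ps] aG x y by (simp add: inv_mult_group m_assoc)
    qed
    then have "x \<otimes> inv y \<in> conj_core A P" using x y by (auto simp: conj_core_def)
    then show "conj_core A P #> x = conj_core A P #> y" using rcoset_eq_iff[OF D] x y by blast
  qed
  then show ?thesis using D by (simp add: finite_index_def rcosets_eq_image)
qed

lemma conj_core_subset:
  assumes "\<one> \<in> A"
  shows "conj_core A P \<subseteq> P"
  using assms by (force simp: conj_core_def)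

text \<open>Conjugating by \<open>a\<close> and then by \<open>b\<close> is conjugating by
  \<open>b \<otimes> a\<close>, which is again in \<open>A\<close>.\<close>

lemma conj_core_conj_closed:
  assumes A: "subgroup A G" and a: "a \<in> A" and x: "x \<in> conj_core A P"
  shows "a \<otimes> x \<otimes> inv a \<in> conj_core A P"
proof -
  have G: "a \<in> carrier G" "x \<in> carrier G"
    using a x subgroup.mem_carrier[OF A] by (auto simp: conj_core_def)
  have "b \<otimes> (a \<otimes> x \<otimes> inv a) \<otimes> inv b \<in> P" if b: "b \<in> A" for b
  proof -
    have bG: "b \<in> carrier G" using b subgroup.mem_carrier[OF A] by blast
    have "b \<otimes> (a \<otimes> x \<otimes> inv a) \<otimes> inv b = (b \<otimes> a) \<otimes> x \<otimes> inv (b \<otimes> a)"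
      using G bG by (simp add: inv_mult_group m_assoc)
    then show ?thesis using x subgroup.m_closed[OF A b a] by (simp add: conj_core_def)
  qed
  then show ?thesis using G by (simp add: conj_core_def)
qed

text \<open>Since \<open>A\<close> normalises \<open>D\<close>, the product \<open>D <#> A\<close>
  is itself a subgroup.\<close>

lemma generate_subset_set_mult:
  assumes A: "subgroup A G" and D: "subgroup D G"
    and norm: "\<And>a x. a \<in> A \<Longrightarrow> x \<in> D \<Longrightarrow> a \<otimes> x \<otimes> inv a \<in> D"
  shows "generate G (A \<union> D) \<subseteq> D <#> A"
proof -
  have AG: "\<And>a. a \<in> A \<Longrightarrow> a \<in> carrier G" and DG: "\<And>x. x \<in> D \<Longrightarrow> x \<in> carrier G"
    by (rule subgroup.mem_carrier[OF A], assumption) (rule subgroup.mem_carrier[OF D])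
  have "subgroup (D <#> A) G"
  proof (rule subgroupI)
    show "D <#> A \<subseteq> carrier G" using AG DG by (auto simp: set_mult_def)
    show "D <#> A \<noteq> {}"
      using subgroup.one_closed[OF A] subgroup.one_closed[OF D] by (auto simp: set_mult_def)
  next
    fix z assume "z \<in> D <#> A"
    then obtain d a where z: "d \<in> D" "a \<in> A" "z = d \<otimes> a" by (auto simp: set_mult_def)
    have "inv a \<otimes> inv d \<otimes> inv (inv a) \<in> D"
      using z norm subgroup.m_inv_closed[OF A] subgroup.m_inv_closed[OF D] by blast
    moreover have "inv z = (inv a \<otimes> inv d \<otimes> inv (inv a)) \<otimes> inv a"
      using z AG DG by (simp add: inv_mult_group m_assoc)
    ultimately show "inv z \<in> D <#> A"
      using z subgroup.m_inv_closed[OF A] unfolding set_mult_def by blast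
  next
    fix z w assume "z \<in> D <#> A" "w \<in> D <#> A"
    then obtain d a e b where z: "d \<in> D" "a \<in> A" "z = d \<otimes> a" and w: "e \<in> D" "b \<in> A" "w = e \<otimes> b"
      by (auto simp: set_mult_def)
    have "d \<otimes> (a \<otimes> e \<otimes> inv a) \<in> D" using z w norm subgroup.m_closed[OF D] by blast
    moreover have "z \<otimes> w = (d \<otimes> (a \<otimes> e \<otimes> inv a)) \<otimes> (a \<otimes> b)"
      using z w AG DG by (simp add: m_assoc inv_mult_cancel_left)
    ultimately show "z \<otimes> w \<in> D <#> A"
      using z w subgroup.m_closed[OF A] unfolding set_mult_def by blast
  qed
  moreover have "A \<union> D \<subseteq> D <#> A"
    using subgroup.one_closed[OF A] subgroup.one_closed[OF D] AG DG
    by (force simp: set_mult_def)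
  ultimately show ?thesis using generate_subgroup_incl by blast
qed

lemma generate_Un_generate:
  assumes "S \<subseteq> carrier G" "T \<subseteq> carrier G"
  shows "generate G (generate G S \<union> generate G T) = generate G (S \<union> T)"
proof
  have "generate G S \<union> generate G T \<subseteq> generate G (S \<union> T)"
    by (simp add: mono_generate)
  then show "generate G (generate G S \<union> generate G T) \<subseteq> generate G (S \<union> T)"
    using assms generate_subgroup_incl generate_is_subgroup by (metis Un_least)
  show "generate G (S \<union> T) \<subseteq> generate G (generate G S \<union> generate G T)"
    by (rule mono_generate) (auto intro: generate.incl)
qed

section \<open>What positive rank gradient and LPF provide\<close>

text \<open>The inequality is strict because the rank gradient bounds the rank minus 1. It is used
  to refute finite index for subgroups with few generators.\<close>

lemma rank_gradient_bound:
  assumes "finite T" "T \<subseteq> carrier G" "finite_index G (generate G T)"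
  shows "rank_gradient G * card (rcosets (generate G T)) < card T"
proof -
  let ?U = "generate G T"
  let ?R = "{(real (min_gens G U) - 1) / real (card (rcosets U)) | U. finite_index G U}"
  have "bdd_below ?R"
  \<comment> \<open>The numerator is at least -1 and a positive index at least 1; for cardinality 0
    the quotient is 0 by convention.\<close>
  proof (rule bdd_belowI[of _ "-1"], clarify)
    fix U assume "finite_index G U"
    show "- 1 \<le> (real (min_gens G U) - 1) / real (card (rcosets U))"
      by (cases "card (rcosets U) = 0") (auto simp: field_simps)
  qed
  then have "rank_gradient G \<le> (real (min_gens G ?U) - 1) / real (card (rcosets ?U))"
    unfolding rank_gradient_def using assms(3) by (intro cInf_lower) auto
  moreover have "card (rcosets ?U) > 0"
    using assms(3) by (auto simp: finite_index_def card_gt_0_iff rcosets_eq_image)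
  moreover have "min_gens G ?U \<le> card T"
    unfolding min_gens_def using assms by (intro Least_le) blast
  ultimately show ?thesis by (simp add: field_simps)
qed

lemma LPF_large_overgroup:
  assumes "LPF G" "fg_subgroup G H" "gindex G H = \<infinity>"
  obtains U where "finite_index G U" "H \<subseteq> U" "(c::real) \<le> card (rcosets U)"
proof -
  have "Sup {enat (card (rcosets U)) | U. finite_index G U \<and> H \<subseteq> U} = \<infinity>"
    using assms unfolding LPF_def proindex_def by auto
  then have "enat (nat \<lceil>c\<rceil>) < Sup {enat (card (rcosets U)) | U. finite_index G U \<and> H \<subseteq> U}"
    by simp
  then obtain U where "finite_index G U" "H \<subseteq> U" "nat \<lceil>c\<rceil> < card (rcosets U)"
    unfolding less_Sup_iff by auto
  then show ?thesis by (intro that[of U]) linarith+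
qed

end

section \<open>Two generator counts that rule out finite index\<close>

theorem theorem3p4:
  fixes G :: "('a, 'b) monoid_scheme" and A B :: "'a set"
  assumes "fg_group G" and "LPF G" and "rank_gradient G > 0"
    and "fg_subgroup G A" and "gindex G A = \<infinity>"
    and "fg_subgroup G B" and "gindex G B = \<infinity>"
  shows "\<exists>B0. subgroup B0 G \<and> B0 \<subseteq> B \<and> finite_index (G\<lparr>carrier := B\<rparr>) B0
             \<and> gindex G (generate G (A \<union> B0)) = \<infinity>"
proof -
  interpret group G using assms(1) by (simp add: fg_group_def)
  define r where "r = rank_gradient G"
  have r: "r > 0" using assms(3) by (simp add: r_def)
  have A: "subgroup A G" and B: "subgroup B G" using assms(4,6) by (auto simp: fg_subgroup_def)
  have AG: "A \<subseteq> carrier G" and BG: "B \<subseteq> carrier G" using A B subgroup.subset by blast+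
  obtain S where S: "finite S" "S \<subseteq> carrier G" "generate G S = A"
    using assms(4) by (auto simp: fg_subgroup_def)
  obtain T where T: "finite T" "T \<subseteq> carrier G" "generate G T = B"
    using assms(6) by (auto simp: fg_subgroup_def)
  \<comment> \<open>The factor 2 here and in the choice of \<open>V\<close> makes each of the two
    terms bounding the number of generators of \<open>H\<close> at most half of \<open>r\<close>
    times the index of \<open>U \<inter> V\<close>.\<close>
  obtain U where U: "finite_index G U" "A \<subseteq> U" "2 * card S / r \<le> card (rcosets\<^bsub>G\<^esub> U)"
    using LPF_large_overgroup[OF assms(2,4,5)] by blast
  obtain V where V: "finite_index G V" "B \<subseteq> V" "2 * card T / r \<le> card (rcosets\<^bsub>G\<^esub> V)"
    using LPF_large_overgroup[OF assms(2,6,7)] by blast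
  have fin: "finite ((#>\<^bsub>G\<^esub>) E ` C)" if "finite_index G E" "C \<subseteq> carrier G" for E C
    using that unfolding finite_index_def rcosets_eq_image by (meson finite_subset image_mono)
  have Us: "subgroup U G" and Vs: "subgroup V G" using U V by (auto simp: finite_index_def)
  obtain S0 where S0: "finite S0" "S0 \<subseteq> carrier G" "generate G S0 = A \<inter> V"
    "card S0 \<le> card S * card ((#>\<^bsub>G\<^esub>) V ` A)"
    using schreier_generators[OF S Vs fin[OF V(1) AG]] by blast
  obtain T0 where T0: "finite T0" "T0 \<subseteq> carrier G" "generate G T0 = B \<inter> U"
    "card T0 \<le> card T * card ((#>\<^bsub>G\<^esub>) U ` B)"
    using schreier_generators[OF T Us fin[OF U(1) BG]] by blast
  define H where "H = generate G (S0 \<union> T0)"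
  have STG: "S0 \<union> T0 \<subseteq> carrier G" using S0 T0 by blast
  have Hs: "subgroup H G" unfolding H_def using STG generate_is_subgroup by blast
  have "\<not> finite_index G H"
  proof
    assume fH: "finite_index G H"
    define E where "E = U \<inter> V"
    have E: "finite_index G E" unfolding E_def using U V finite_index_Int by blast
    have Es: "subgroup E G" using E by (simp add: finite_index_def)
    have "S0 \<union> T0 \<subseteq> E"
      using generate.incl[of _ S0 G] generate.incl[of _ T0 G] S0(3) T0(3) U V unfolding E_def by blast
    then have HE: "H \<subseteq> E" unfolding H_def using Es generate_subgroup_incl by blast
    \<comment> \<open>As \<open>E\<close> lies in \<open>V\<close>, its cosets are finer.\<close>
    have a: "card ((#>\<^bsub>G\<^esub>) V ` A) \<le> card ((#>\<^bsub>G\<^esub>) E ` A)"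
      by (rule card_image_factor[OF fin[OF E AG]])
        (use AG Es Vs in \<open>auto simp: rcoset_eq_iff subset_iff E_def\<close>)
    have b: "card ((#>\<^bsub>G\<^esub>) U ` B) \<le> card ((#>\<^bsub>G\<^esub>) E ` B)"
      by (rule card_image_factor[OF fin[OF E BG]])
        (use BG Es Us in \<open>auto simp: rcoset_eq_iff subset_iff E_def\<close>)
    let ?I = "real (card (rcosets\<^bsub>G\<^esub> E))"
    let ?a = "real (card ((#>\<^bsub>G\<^esub>) V ` A))"
    let ?b = "real (card ((#>\<^bsub>G\<^esub>) U ` B))"
    have "card (rcosets\<^bsub>G\<^esub> U) * card ((#>\<^bsub>G\<^esub>) V ` A) \<le> card (rcosets\<^bsub>G\<^esub> E)"
      using card_rcosets_ge_mult[OF E Us _ U(2)] a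
      by (metis E_def inf_le1 le_trans mult_le_mono2)
    then have Ia: "real (card (rcosets\<^bsub>G\<^esub> U)) * ?a \<le> ?I" by (metis of_nat_le_iff of_nat_mult)
    have "card (rcosets\<^bsub>G\<^esub> V) * card ((#>\<^bsub>G\<^esub>) U ` B) \<le> card (rcosets\<^bsub>G\<^esub> E)"
      using card_rcosets_ge_mult[OF E Vs _ V(2)] b
      by (metis E_def inf_le2 le_trans mult_le_mono2)
    then have Ib: "real (card (rcosets\<^bsub>G\<^esub> V)) * ?b \<le> ?I" by (metis of_nat_le_iff of_nat_mult)
    have "2 * card S / r * ?a \<le> ?I"
      by (rule order_trans[OF mult_right_mono[OF U(3)] Ia]) simp
    then have 1: "2 * (card S * ?a) \<le> r * ?I" using r by (simp add: field_simps)
    have "2 * card T / r * ?b \<le> ?I"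
      by (rule order_trans[OF mult_right_mono[OF V(3)] Ib]) simp
    then have 2: "2 * (card T * ?b) \<le> r * ?I" using r by (simp add: field_simps)
    \<comment> \<open>The cycle closes: \<open>r * ?I\<close> is strictly below a sum of two terms,
      each at most half of it.\<close>
    have "r * ?I \<le> r * card (rcosets\<^bsub>G\<^esub> H)"
      using card_rcosets_antimono[OF fH Es HE] r by simp
    also have "\<dots> < card (S0 \<union> T0)"
      using rank_gradient_bound[of "S0 \<union> T0"] S0 T0 fH STG by (simp add: r_def H_def)
    also have "\<dots> \<le> real (card S0) + real (card T0)" using card_Un_le[of S0 T0] by linarith
    also have "\<dots> \<le> card S * ?a + card T * ?b"
      using S0(4) T0(4) by (intro add_mono) (metis of_nat_le_iff of_nat_mult)+
    finally show False using 1 2 by linarith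
  qed
  then have Hinf: "gindex G H = \<infinity>" using Hs by (simp add: gindex_def finite_index_def)
  have Hfg: "fg_subgroup G H"
    using Hs S0(1) T0(1) STG unfolding fg_subgroup_def H_def by blast
  have AVH: "A \<inter> V \<subseteq> H" and BUH: "B \<inter> U \<subseteq> H"
    using S0(3) T0(3) mono_generate[of S0 "S0 \<union> T0"] mono_generate[of T0 "S0 \<union> T0"]
    unfolding H_def by auto
  \<comment> \<open>The bound on the relative index of \<open>D\<close> in \<open>A\<close>. It
    depends only on \<open>A\<close> and \<open>V\<close>, so \<open>P\<close> can be chosen
    afterwards with an index that is large compared to \<open>k\<close>.\<close>
  define k where "k = real (card ((#>\<^bsub>G\<^esub>) (conj_core A V) ` A))"
  have one: "\<one>\<^bsub>G\<^esub> \<in> A" using A subgroup.one_closed by blast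
  have k: "k > 0" unfolding k_def
    using fin[OF finite_index_conj_core[OF AG V(1)] AG] one by (auto simp: card_gt_0_iff)
  obtain P where P: "finite_index G P" "H \<subseteq> P"
    "2 * k * (real (card S) + real (card T0)) / r \<le> card (rcosets\<^bsub>G\<^esub> P)"
    using LPF_large_overgroup[OF assms(2) Hfg Hinf] by blast
  have Ps: "subgroup P G" using P by (simp add: finite_index_def)
  define D where "D = conj_core A P"
  have D: "finite_index G D" unfolding D_def using finite_index_conj_core AG P by blast
  have Ds: "subgroup D G" using D by (simp add: finite_index_def)
  have DP: "D \<subseteq> P" unfolding D_def using one conj_core_subset by blast
  \<comment> \<open>All \<open>A\<close>-conjugates of such an element lie in
    \<open>A \<inter> V\<close>, hence in \<open>H\<close> and in \<open>P\<close>, whichever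
    \<open>P\<close> was chosen.\<close>
  have core: "A \<inter> conj_core A V \<subseteq> D"
  proof
    fix x assume x: "x \<in> A \<inter> conj_core A V"
    have "a \<otimes>\<^bsub>G\<^esub> x \<otimes>\<^bsub>G\<^esub> inv\<^bsub>G\<^esub> a \<in> P" if a: "a \<in> A" for a
    proof -
      have "a \<otimes>\<^bsub>G\<^esub> x \<otimes>\<^bsub>G\<^esub> inv\<^bsub>G\<^esub> a \<in> A"
        using A a x by (simp add: subgroup.m_closed subgroup.m_inv_closed)
      then show ?thesis using x a AVH P(2) by (auto simp: conj_core_def)
    qed
    then show "x \<in> D" using x unfolding D_def by (auto simp: conj_core_def)
  qed
  have "card ((#>\<^bsub>G\<^esub>) D ` A) \<le> card ((#>\<^bsub>G\<^esub>) (conj_core A V) ` A)"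
  proof (rule card_image_factor[OF fin[OF finite_index_conj_core[OF AG V(1)] AG]])
    fix x y assume xy: "x \<in> A" "y \<in> A" "conj_core A V #>\<^bsub>G\<^esub> x = conj_core A V #>\<^bsub>G\<^esub> y"
    have G: "x \<in> carrier G" "y \<in> carrier G" using xy AG by auto
    have "x \<otimes>\<^bsub>G\<^esub> inv\<^bsub>G\<^esub> y \<in> A" using xy A by (simp add: subgroup.m_closed subgroup.m_inv_closed)
    moreover have "x \<otimes>\<^bsub>G\<^esub> inv\<^bsub>G\<^esub> y \<in> conj_core A V"
      using rcoset_eq_iff[OF subgroup_conj_core[OF AG Vs] G] xy by blast
    ultimately show "D #>\<^bsub>G\<^esub> x = D #>\<^bsub>G\<^esub> y" using rcoset_eq_iff[OF Ds G] core by blast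
  qed
  then have kD: "real (card ((#>\<^bsub>G\<^esub>) D ` A)) \<le> k" by (simp add: k_def)
  define B1 where "B1 = B \<inter> (U \<inter> D)"
  have B1: "finite_index (G\<lparr>carrier := B\<rparr>) B1"
    unfolding B1_def using finite_index_restrict finite_index_Int U(1) D B by blast
  have B1s: "subgroup B1 G" unfolding B1_def using B Us Ds subgroups_Inter_pair by metis
  have BUG: "B \<inter> U \<subseteq> carrier G" using BG by blast
  \<comment> \<open>Schreier's bound is applied to \<open>B \<inter> U\<close> rather than
    \<open>B\<close>: since \<open>B \<inter> U\<close> lies in \<open>P\<close>, the number of
    \<open>D\<close>-cosets meeting it is at most the index of \<open>D\<close> divided by that of
    \<open>P\<close>.\<close>
  obtain T1 where T1: "finite T1" "T1 \<subseteq> carrier G" "generate G T1 = B \<inter> U \<inter> D"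
    "card T1 \<le> card T0 * card ((#>\<^bsub>G\<^esub>) D ` (B \<inter> U))"
    using schreier_generators[OF T0(1-3) Ds fin[OF D BUG]] by blast
  define W where "W = generate G (A \<union> B1)"
  have ABG: "A \<union> B1 \<subseteq> carrier G" using AG BG unfolding B1_def by blast
  have Ws: "subgroup W G" unfolding W_def using ABG generate_is_subgroup by blast
  have WST: "W = generate G (S \<union> T1)"
    using generate_Un_generate[OF S(2) T1(2)] S(3) T1(3) unfolding W_def B1_def by (simp add: Int_assoc)
  have "\<not> finite_index G W"
  proof
    assume fW: "finite_index G W"
    let ?I = "real (card (rcosets\<^bsub>G\<^esub> D))"
    let ?N = "real (card (rcosets\<^bsub>G\<^esub> P))"
    let ?e = "real (card ((#>\<^bsub>G\<^esub>) D ` (B \<inter> U)))"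
    let ?w = "real (card (rcosets\<^bsub>G\<^esub> W))"
    have WDA: "W \<subseteq> D <#>\<^bsub>G\<^esub> A"
    proof -
      have "W \<subseteq> generate G (A \<union> D)" unfolding W_def B1_def by (rule mono_generate) blast
      also have "\<dots> \<subseteq> D <#>\<^bsub>G\<^esub> A"
        by (rule generate_subset_set_mult[OF A Ds]) (simp add: D_def conj_core_conj_closed[OF A])
      finally show ?thesis .
    qed
    \<comment> \<open>Left factors from \<open>D\<close> are absorbed, so every
      \<open>D\<close>-coset that meets \<open>W\<close> already meets \<open>A\<close>. This bounds
      the index of \<open>D\<close> by \<open>k\<close> times that of \<open>W\<close>.\<close>
    have DWA: "(#>\<^bsub>G\<^esub>) D ` W \<subseteq> (#>\<^bsub>G\<^esub>) D ` A"
    proof clarify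
      fix w assume "w \<in> W"
      then obtain d a where da: "d \<in> D" "a \<in> A" "w = d \<otimes>\<^bsub>G\<^esub> a"
        using WDA by (auto simp: set_mult_def)
      then have G: "d \<in> carrier G" "a \<in> carrier G" using AG subgroup.mem_carrier[OF Ds] by auto
      have "D #>\<^bsub>G\<^esub> w = D #>\<^bsub>G\<^esub> a"
        using da G rcoset_eq_iff[OF Ds, of w a] by (simp add: m_assoc)
      then show "D #>\<^bsub>G\<^esub> w \<in> (#>\<^bsub>G\<^esub>) D ` A" using da by blast
    qed
    then have finDW: "finite ((#>\<^bsub>G\<^esub>) D ` W)" using fin[OF D AG] finite_subset by blast
    have "real (card ((#>\<^bsub>G\<^esub>) D ` W)) \<le> k"
      using card_mono[OF fin[OF D AG] DWA] kD by linarith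
    moreover have "?I \<le> real (card ((#>\<^bsub>G\<^esub>) D ` W)) * ?w"
      using card_rcosets_le_mult[OF fW Ds finDW] by (metis of_nat_le_iff of_nat_mult)
    ultimately have Iw: "?I \<le> k * ?w"
      by (meson mult_right_mono of_nat_0_le_iff order_trans)
    have "r * ?w < card (S \<union> T1)"
      using rank_gradient_bound[of "S \<union> T1"] S T1 fW by (simp add: r_def WST)
    also have "\<dots> \<le> real (card S) + real (card T1)" using card_Un_le[of S T1] by linarith
    also have "\<dots> \<le> card S + card T0 * ?e" using T1(4) by (metis add_left_mono of_nat_le_iff of_nat_mult)
    finally have "k * (r * ?w) < k * (card S + card T0 * ?e)" using k by simp
    then have "r * ?I < k * (card S + card T0 * ?e)"
      using mult_left_mono[OF Iw less_imp_le[OF r]] by (simp add: mult.left_commute)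
    \<comment> \<open>The choice of \<open>P\<close> now makes each of the two terms at most half of
      \<open>r * ?I\<close>, against the strict inequality just obtained.\<close>
    moreover have "2 * (k * card S) \<le> r * ?I"
    proof -
      have "2 * (k * card S) \<le> 2 * k * (real (card S) + real (card T0))"
        using k by (simp add: algebra_simps)
      also have "\<dots> \<le> r * ?N" using P(3) r by (simp add: field_simps)
      also have "\<dots> \<le> r * ?I" using card_rcosets_antimono[OF D Ps DP] r by simp
      finally show ?thesis .
    qed
    moreover have "2 * (k * (card T0 * ?e)) \<le> r * ?I"
    proof -
      have "2 * k * card T0 \<le> 2 * k * (real (card S) + real (card T0))"
        using k by (simp add: algebra_simps)
      also have "\<dots> \<le> r * ?N" using P(3) r by (simp add: field_simps)
      finally have "2 * k * card T0 * ?e \<le> r * ?N * ?e" by (rule mult_right_mono) simp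
      moreover have "?N * ?e \<le> ?I"
        using card_rcosets_ge_mult[OF D Ps DP, of "B \<inter> U"] BUH P(2)
        by (metis of_nat_le_iff of_nat_mult order_trans)
      then have "r * (?N * ?e) \<le> r * ?I" using r by simp
      ultimately show ?thesis by (simp add: algebra_simps)
    qed
    ultimately show False by (simp add: algebra_simps)
  qed
  then have "gindex G W = \<infinity>" using Ws by (simp add: gindex_def finite_index_def)
  then show ?thesis using B1s B1 unfolding W_def by (intro exI[of _ B1]) (auto simp: B1_def)
qed

end
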